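(* Let $G$ be a finite $2$-connected graph. Then every edge of $G$ is contained in a cycle of $G$ whose length is at least $\operatorname{td}(G)$. Consequently, $\operatorname{td}(G)$ is at most the circumference of $G$.
   Context: All graphs are finite and simple. A connected graph $G$ is $2$-connected if it has at least three vertices and no cutvertex (a vertex $x$ such that $G-x$ is disconnected). The circumference of $G$ is the length (number of edges) of a longest cycle in $G$, or $+\infty$ if $G$ has no cycle. An elimination forest of a graph $G$ is a rooted forest with trees $T_1,\dots,T_p$ such that $V(T_1),\dots,V(T_p)$ partition $V(G)$ and, for every edge $xy\in E(G)$, $x$ and $y$ lie in the same tree $T_i$ and one of them is an ancestor of the other in $T_i$. Its vertex-height is the maximum number of vertices on a root-to-leaf path in any of its trees. The treedepth $\operatorname{td}(G)$ is the minimum vertex-height of an elimination forest of $G$. *)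

theory Defs
  imports
    "Graph_Theory.Graph_Theory"
    "HOL-Library.Disjoint_Sets"
    "HOL-Library.Extended_Nat"
begin

text \<open>
  Finite simple graphs are those satisfying \<^term>\<open>graph\<close>: an undirected edge is a pair of
  opposite arcs.  The closed walk a, b, a along one edge satisfies \<^term>\<open>pre_digraph.cycle\<close>,
  hence the bound on the length below.
\<close>

definition graph_cycle :: "('a, 'b) pre_digraph \<Rightarrow> 'b awalk \<Rightarrow> bool" where
  "graph_cycle G C \<longleftrightarrow> pre_digraph.cycle G C \<and> 3 \<le> length C"

definition circumference :: "('a, 'b) pre_digraph \<Rightarrow> enat" where
  "circumference G =
    (if \<exists>C. graph_cycle G C then enat (Max {length C | C. graph_cycle G C}) else \<infinity>)"

definition cutvertex :: "('a, 'b) pre_digraph \<Rightarrow> 'a \<Rightarrow> bool" where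
  "cutvertex G x \<longleftrightarrow> x \<in> verts G \<and> \<not> Digraph_Component.connected (pre_digraph.del_vert G x)"

definition two_connected :: "('a, 'b) pre_digraph \<Rightarrow> bool" where
  "two_connected G \<longleftrightarrow>
    Digraph_Component.connected G \<and> 3 \<le> card (verts G) \<and> (\<forall>x \<in> verts G. \<not> cutvertex G x)"

text \<open>
  A rooted tree has its edges oriented away from the root, so that the ancestors of a vertex
  (itself included) are the vertices from which it is reachable, and the leaves are the vertices
  without outgoing arcs.  The predicates \<^term>\<open>tree\<close> and \<^term>\<open>forest\<close> of the library only
  exclude directed cycles and do not describe trees here.
\<close>

definition rooted_tree :: "'a pair_pre_digraph \<Rightarrow> 'a \<Rightarrow> bool" where
  "rooted_tree T r \<longleftrightarrow>
    pair_wf_digraph T \<and> r \<in> pverts T \<and> (\<forall>v \<in> pverts T. \<exists>!p. pre_digraph.awalk (with_proj T) r p v)"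

definition rooted_forest :: "('a pair_pre_digraph \<times> 'a) set \<Rightarrow> bool" where
  "rooted_forest F \<longleftrightarrow>
    finite F \<and> (\<forall>(T, r) \<in> F. rooted_tree T r) \<and> disjoint_family_on (\<lambda>(T, r). pverts T) F"

definition elimination_forest ::
    "('a, 'b) pre_digraph \<Rightarrow> ('a pair_pre_digraph \<times> 'a) set \<Rightarrow> bool" where
  "elimination_forest G F \<longleftrightarrow>
    rooted_forest F \<and>
    (\<Union>(T, r) \<in> F. pverts T) = verts G \<and>
    (\<forall>(x, y) \<in> arcs_ends G. \<exists>(T, r) \<in> F.
        x \<in> pverts T \<and> y \<in> pverts T \<and> (x \<rightarrow>\<^sup>*\<^bsub>with_proj T\<^esub> y \<or> y \<rightarrow>\<^sup>*\<^bsub>with_proj T\<^esub> x))"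

text \<open>On natural numbers \<^term>\<open>Sup\<close> is the maximum, and 0 for the empty forest.\<close>

definition vertex_height :: "('a pair_pre_digraph \<times> 'a) set \<Rightarrow> nat" where
  "vertex_height F =
    Sup {length (pre_digraph.awalk_verts (with_proj T) r p) | T r p l.
      (T, r) \<in> F \<and> pre_digraph.apath (with_proj T) r p l \<and> out_arcs (with_proj T) l = {}}"

definition treedepth :: "('a, 'b) pre_digraph \<Rightarrow> nat" where
  "treedepth G = (LEAST h. \<exists>F. elimination_forest G F \<and> vertex_height F = h)"

end

theory Submission
  imports Defs
begin

text \<open>
  Closing up the edge, one needs a path between its ends \<open>u\<close>, \<open>v\<close> with at least td(G) vertices.
  Deleting \<open>u\<close> and \<open>v\<close> and passing to a component of largest treedepth, this follows from a statement
  proved by induction on \<open>K\<close>: if \<open>K\<close> is connected, \<open>W\<close> and \<open>S\<close> meet \<open>K\<close>, and for every vertex \<open>x\<close>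
  each component of \<open>K - x\<close> meets \<open>W \<union> S\<close>, then \<open>K\<close> contains a path from \<open>W\<close> to \<open>S\<close> with at least
  td(K) vertices.

  If for some \<open>c\<close> no component of \<open>K - c\<close> meets both \<open>W\<close> and \<open>S\<close>, take a component \<open>L\<close> of largest
  treedepth, a long path in \<open>L\<close> from \<open>W \<union> S\<close> to a neighbour of \<open>c\<close>, and continue through \<open>c\<close> to the
  other one of the two sets. Otherwise there is a block \<open>B\<close> of \<open>K\<close> such that for every \<open>d\<close> in \<open>B\<close> the
  part of \<open>K\<close> that attaches to \<open>B\<close> outside \<open>d\<close> meets both \<open>W\<close> and \<open>S\<close>. As every component of
  \<open>K - B\<close> hangs at a single vertex, td(K) is at most td(B) + td(L) for some component \<open>L\<close> of \<open>K - B\<close>,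
  hanging at \<open>c\<close> say. A long path in \<open>L\<close> from \<open>W \<union> S\<close> to \<open>c\<close> is continued by a path in \<open>B\<close> with at
  least td(B) vertices, ending where the other set attaches.
\<close>

section \<open>Paths and treedepth of vertex sets\<close>

locale adjacency =
  fixes adj :: "'a \<Rightarrow> 'a \<Rightarrow> bool"
  assumes adj_sym: "adj x y \<Longrightarrow> adj y x"
begin

text \<open>Membership in \<open>X\<close> is asked of steps only, so \<open>reach X x x\<close>
  holds even for \<open>x\<close> outside \<open>X\<close>; hence the premise
  \<open>x \<in> X\<close> in several lemmas.\<close>

definition reach :: "'a set \<Rightarrow> 'a \<Rightarrow> 'a \<Rightarrow> bool" where
  "reach X = (\<lambda>x y. x \<in> X \<and> y \<in> X \<and> adj x y)\<^sup>*\<^sup>*"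

definition conn :: "'a set \<Rightarrow> bool" where
  "conn X \<longleftrightarrow> (\<forall>x\<in>X. \<forall>y\<in>X. reach X x y)"

definition component :: "'a set \<Rightarrow> 'a \<Rightarrow> 'a set" where
  "component X x = {y. reach X x y}"

definition vpath :: "'a set \<Rightarrow> 'a list \<Rightarrow> bool" where
  "vpath X p \<longleftrightarrow> p \<noteq> [] \<and> distinct p \<and> set p \<subseteq> X \<and> successively adj p"

text \<open>Upper bounds on the treedepth of the subgraph induced on \<open>X\<close>, in recursive
  form: deleting a vertex costs one, and parts without edges between them share a bound.\<close>

inductive td_le :: "'a set \<Rightarrow> nat \<Rightarrow> bool" where
  empty: "td_le {} n"
| remove: "x \<in> X \<Longrightarrow> td_le (X - {x}) n \<Longrightarrow> td_le X (Suc n)"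
| disjoint_union: "td_le X n \<Longrightarrow> td_le Y n \<Longrightarrow> X \<inter> Y = {} \<Longrightarrow>
    (\<And>x y. x \<in> X \<Longrightarrow> y \<in> Y \<Longrightarrow> \<not> adj x y) \<Longrightarrow> td_le (X \<union> Y) n"

section \<open>Reachability and components inside a vertex set\<close>

lemma reach_refl [simp]: "reach X x x"
  by (simp add: reach_def)

lemma reach_trans: "reach X x y \<Longrightarrow> reach X y z \<Longrightarrow> reach X x z"
  unfolding reach_def by (rule rtranclp_trans)

lemma reach_adj: "x \<in> X \<Longrightarrow> y \<in> X \<Longrightarrow> adj x y \<Longrightarrow> reach X x y"
  unfolding reach_def by blast

lemma reach_step: "reach X x y \<Longrightarrow> y \<in> X \<Longrightarrow> z \<in> X \<Longrightarrow> adj y z \<Longrightarrow> reach X x z"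
  by (blast intro: reach_trans reach_adj)

lemma reach_induct [consumes 1, case_names refl step]:
  assumes "reach X x y" "P x"
    and "\<And>y z. reach X x y \<Longrightarrow> y \<in> X \<Longrightarrow> z \<in> X \<Longrightarrow> adj y z \<Longrightarrow> P y \<Longrightarrow> P z"
  shows "P y"
  using assms(1) unfolding reach_def
  by (induction rule: rtranclp_induct) (use assms(2,3) in \<open>auto simp: reach_def\<close>)

lemma reach_in: "reach X x y \<Longrightarrow> x \<in> X \<Longrightarrow> y \<in> X"
  by (induction rule: reach_induct) auto

lemma reach_sym: "reach X x y \<Longrightarrow> reach X y x"
proof (induction rule: reach_induct)
  case (step y z)
  then show ?case by (blast intro: reach_trans reach_adj adj_sym)
qed simp

lemma reach_mono: "reach X x y \<Longrightarrow> X \<subseteq> Y \<Longrightarrow> reach Y x y"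
  by (induction rule: reach_induct) (auto intro: reach_step)

text \<open>Mostly used with \<open>D\<close> a component or a hanging part, to extract the edge by
  which a walk leaves it.\<close>

lemma reach_exit:
  assumes "reach Y y z" "y \<in> D" "z \<notin> D"
  obtains a b where "a \<in> D" "a \<in> Y" "b \<in> Y" "b \<notin> D" "adj a b"
proof -
  have "z \<in> D \<or> (\<exists>a b. a \<in> D \<and> a \<in> Y \<and> b \<in> Y \<and> b \<notin> D \<and> adj a b)"
    using assms(1) by (induction rule: reach_induct) (use assms(2) in blast)+
  then show thesis using assms(3) that by blast
qed

lemma component_subset: "x \<in> X \<Longrightarrow> component X x \<subseteq> X"
  by (auto simp: component_def dest: reach_in)

lemma component_self [simp]: "x \<in> component X x"
  by (simp add: component_def)

lemma component_closed: "a \<in> component X x \<Longrightarrow> x \<in> X \<Longrightarrow> b \<in> X \<Longrightarrow> adj a b \<Longrightarrow> b \<in> component X x"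
  by (auto simp: component_def intro: reach_step reach_in)

lemma reach_in_component: "reach X x y \<Longrightarrow> x \<in> X \<Longrightarrow> reach (component X x) x y"
proof (induction rule: reach_induct)
  case (step y z)
  then have "z \<in> component X x" "y \<in> component X x"
    by (auto simp: component_def intro: reach_step)
  with step show ?case by (blast intro: reach_step)
qed simp

lemma conn_component: "x \<in> X \<Longrightarrow> conn (component X x)"
  unfolding conn_def
proof (intro ballI)
  fix y z assume x: "x \<in> X" and "y \<in> component X x" "z \<in> component X x"
  then have "reach (component X x) x y" "reach (component X x) x z"
    using reach_in_component by (auto simp: component_def)
  then show "reach (component X x) y z" by (blast intro: reach_sym reach_trans)
qed

section \<open>Simple paths as vertex lists\<close>

lemma reach_imp_vpath:
  assumes "reach X x y" "x \<in> X"
  obtains p where "vpath X p" "hd p = x" "last p = y"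
proof -
  have "\<exists>p. vpath X p \<and> hd p = x \<and> last p = y" using assms
  proof (induction rule: reach_induct)
    case refl
    then show ?case by (intro exI[of _ "[x]"]) (simp add: vpath_def)
  next
    case (step y z)
    then obtain p where p: "vpath X p" "hd p = x" "last p = y" by blast
    show ?case
    proof (cases "z \<in> set p")
      case True
      \<comment> \<open>The walk returns to the path: cut the path at \<open>z\<close> instead of
        extending it.\<close>
      then obtain q r where "p = q @ z # r" by (meson split_list)
      then show ?thesis using p
        by (intro exI[of _ "q @ [z]"]) (auto simp: vpath_def successively_append_iff hd_append)
    next
      case False
      then show ?thesis using p step
        by (intro exI[of _ "p @ [z]"]) (auto simp: vpath_def successively_append_iff)
    qed
  qed
  then show thesis using that by blast
qed

lemma vpath_rev: "vpath X p \<Longrightarrow> vpath X (rev p)"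
  by (auto simp: vpath_def successively_rev intro: successively_mono adj_sym)

lemma vpath_mono: "vpath X p \<Longrightarrow> X \<subseteq> Y \<Longrightarrow> vpath Y p"
  by (auto simp: vpath_def)

lemma vpath_append:
  "vpath X p \<Longrightarrow> vpath X q \<Longrightarrow> set p \<inter> set q = {} \<Longrightarrow> adj (last p) (hd q) \<Longrightarrow> vpath X (p @ q)"
  by (auto simp: vpath_def successively_append_iff)

lemma vpath_reach: "vpath X p \<Longrightarrow> a \<in> set p \<Longrightarrow> reach X a (last p)"
proof (induction p arbitrary: a)
  case (Cons x p)
  show ?case
  proof (cases "p = []")
    case False
    then have p: "vpath X p" and x: "reach X x (hd p)"
      using Cons.prems(1) by (auto simp: vpath_def successively_Cons intro!: reach_adj)
    then have "reach X (hd p) (last p)" using Cons.IH False by simp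
    then show ?thesis using Cons x p False by (auto intro: reach_trans)
  qed (use Cons in simp)
qed simp

section \<open>Bounds on treedepth\<close>

lemma td_le_Suc: "td_le X n \<Longrightarrow> td_le X (Suc n)"
  by (induction rule: td_le.induct) (auto intro: td_le.intros)

lemma td_le_mono_subset: "td_le X n \<Longrightarrow> Y \<subseteq> X \<Longrightarrow> td_le Y n"
proof (induction arbitrary: Y rule: td_le.induct)
  case (empty n)
  then show ?case by (simp add: td_le.empty)
next
  case (remove x X n)
  show ?case
  proof (cases "x \<in> Y")
    case True
    then show ?thesis using remove by (blast intro: td_le.remove)
  next
    case False
    have "td_le Y n" using False remove by blast
    then show ?thesis by (rule td_le_Suc)
  qed
next
  case (disjoint_union X n Z)
  have "td_le (Y \<inter> X \<union> Y \<inter> Z) n"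
    using disjoint_union by (intro td_le.disjoint_union) auto
  moreover have "Y \<inter> X \<union> Y \<inter> Z = Y" using disjoint_union.prems by blast
  ultimately show ?case by simp
qed

lemma td_le_mono: "m \<le> n \<Longrightarrow> td_le X m \<Longrightarrow> td_le X n"
  by (induction n rule: dec_induct) (auto intro: td_le_Suc)

lemma td_le_remove: "td_le (X - {x}) n \<Longrightarrow> td_le X (Suc n)"
  by (cases "x \<in> X") (auto intro: td_le.remove td_le_Suc)

text \<open>Treedepth is the maximum over the components; in terms of bounds, a component attaining
  it is one all of whose bounds hold for \<open>X\<close>. Split off one component, take a
  dominating one of the rest, and keep the worse of the two.\<close>

lemma dominating_component:
  assumes "finite X" "X \<noteq> {}"
  obtains x where "x \<in> X" "\<forall>n. td_le (component X x) n \<longrightarrow> td_le X n"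
proof -
  have "\<exists>x\<in>X. \<forall>n. td_le (component X x) n \<longrightarrow> td_le X n"
    using assms
  proof (induction X rule: finite_psubset_induct)
    case (psubset X)
    then obtain x where x: "x \<in> X" by blast
    define C where "C = component X x"
    define Y where "Y = X - C"
    have C: "C \<subseteq> X" "x \<in> C" "C \<union> Y = X" "C \<inter> Y = {}"
      using component_subset[OF x] by (auto simp: C_def Y_def)
    have no_adj: "\<not> adj a b" if "a \<in> C" "b \<in> Y" for a b
      using that component_closed x by (auto simp: C_def Y_def)
    have union: "td_le X n" if "td_le C n" "td_le Y n" for n
      using td_le.disjoint_union[OF that] C no_adj by auto
    show ?case
    proof (cases "Y = {}")
      case True
      then have "component X x = X" using C C_def by simp
      then show ?thesis using x by (intro bexI[of _ x]) simp_all
    next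
      case False
      then obtain y where y: "y \<in> Y" "\<And>n. td_le (component Y y) n \<Longrightarrow> td_le Y n"
        using psubset.IH[of Y] C by blast
      \<comment> \<open>No edge joins \<open>C\<close> and \<open>Y\<close>, so walks of
        \<open>X\<close> that start in \<open>Y\<close> stay there.\<close>
      have "reach Y y z" if "reach X y z" for z
        using that
      proof (induction rule: reach_induct)
        case (step a b)
        then have "a \<in> Y" using y(1) reach_in by blast
        then have "b \<in> Y" using step no_adj adj_sym C by blast
        with step \<open>a \<in> Y\<close> show ?case by (blast intro: reach_step)
      qed simp
      then have comp: "component X y = component Y y"
        using reach_mono[of Y y _ X] Y_def unfolding component_def by blast
      show ?thesis
      proof (cases "\<forall>n. td_le C n \<longrightarrow> td_le Y n")
        case True
        then show ?thesis using union x C_def by blast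
      next
        case False
        \<comment> \<open>\<open>m\<close> bounds \<open>C\<close> but not \<open>Y\<close>, so
          every bound for \<open>Y\<close> is at least \<open>m\<close> and bounds \<open>C\<close>
          too.\<close>
        then obtain m where m: "td_le C m" "\<not> td_le Y m" by blast
        have "td_le X n" if "td_le (component X y) n" for n
        proof -
          have "td_le Y n" using that comp y by simp
          moreover have "m \<le> n" using m calculation td_le_mono[of n m Y] by linarith
          ultimately show ?thesis using union td_le_mono[of m n C] m by blast
        qed
        then show ?thesis using y(1) C by blast
      qed
    qed
  qed
  then show thesis using that by blast
qed

section \<open>Retractions onto blocks\<close>

text \<open>Collapses every part of \<open>K\<close> that hangs off \<open>B\<close> at a single vertex onto that vertex.\<close>
definition retraction :: "'a set \<Rightarrow> 'a set \<Rightarrow> ('a \<Rightarrow> 'a) \<Rightarrow> bool" where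
  "retraction K B \<pi> \<longleftrightarrow> B \<subseteq> K \<and> \<pi> ` K \<subseteq> B \<and> (\<forall>b\<in>B. \<pi> b = b) \<and>
    (\<forall>x\<in>K. \<forall>y\<in>K. adj x y \<longrightarrow> \<pi> x \<noteq> \<pi> y \<longrightarrow> x \<in> B \<and> y \<in> B)"

lemma
  assumes "retraction K B \<pi>"
  shows retraction_subset: "B \<subseteq> K"
    and retraction_in: "x \<in> K \<Longrightarrow> \<pi> x \<in> B"
    and retraction_id: "b \<in> B \<Longrightarrow> \<pi> b = b"
    and retraction_adj:
      "x \<in> K \<Longrightarrow> y \<in> K \<Longrightarrow> adj x y \<Longrightarrow> \<pi> x \<noteq> \<pi> y \<Longrightarrow> x \<in> B \<and> y \<in> B"
  using assms unfolding retraction_def by blast+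

text \<open>Pull the elimination of \<open>B\<close> back along \<open>\<pi>\<close>. Once
  \<open>x\<close> in \<open>B\<close> is deleted, the rest of its fibre lies in
  \<open>K - B\<close> and has no edge to other fibres, because edges between fibres have both ends
  in \<open>B\<close>. So these rests are handled in parallel, and \<open>b\<close> is paid only
  once.\<close>

lemma td_le_retraction:
  assumes \<pi>: "retraction K B \<pi>" and B: "td_le B a" and rest: "td_le (K - B) b"
  shows "td_le K (a + b)"
proof -
  have "td_le {x\<in>K. \<pi> x \<in> X} (a + b)" if "td_le X a" "X \<subseteq> B" for X
    using that
  proof (induction rule: td_le.induct)
    case (empty n)
    then show ?case by (simp add: td_le.empty)
  next
    case (remove x X n)
    let ?P = "{y\<in>K. \<pi> y \<in> X - {x}}" and ?Q = "{y\<in>K. \<pi> y = x} - {x}"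
    have "x \<in> B" "\<pi> x = x" using remove \<pi> by (auto simp: retraction_def)
    have "?Q \<subseteq> K - B" using retraction_id[OF \<pi>] by auto
    then have "td_le ?Q (n + b)" using td_le_mono_subset[OF rest] td_le_mono[OF le_add2] by blast
    moreover have "td_le ?P (n + b)" using remove by blast
    moreover have "\<not> adj y z" if "y \<in> ?P" "z \<in> ?Q" for y z
    proof
      assume "adj y z"
      then have "z \<in> B" using retraction_adj[OF \<pi>, of y z] that by simp
      then show False using retraction_id[OF \<pi>, of z] that by simp
    qed
    ultimately have "td_le (?P \<union> ?Q) (n + b)"
      by (intro td_le.disjoint_union) auto
    moreover have "{y\<in>K. \<pi> y \<in> X} - {x} = ?P \<union> ?Q"
      using remove.hyps \<open>\<pi> x = x\<close> by auto
    ultimately have "td_le ({y\<in>K. \<pi> y \<in> X} - {x}) (n + b)" by (simp only:)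
    then show ?case using td_le_remove by simp
  next
    case (disjoint_union X n Y)
    have "td_le ({x\<in>K. \<pi> x \<in> X} \<union> {x\<in>K. \<pi> x \<in> Y}) (n + b)"
    proof (rule td_le.disjoint_union)
      fix x y assume "x \<in> {x\<in>K. \<pi> x \<in> X}" "y \<in> {x\<in>K. \<pi> x \<in> Y}"
      then have xy: "x \<in> K" "y \<in> K" "\<pi> x \<in> X" "\<pi> y \<in> Y" by auto
      then have "\<pi> x \<noteq> \<pi> y" using disjoint_union.hyps by auto
      then show "\<not> adj x y"
        using retraction_adj[OF \<pi> xy(1,2)] retraction_id[OF \<pi>] xy(3,4) disjoint_union.hyps(4)
        by metis
    qed (use disjoint_union in auto)
    moreover have "{x\<in>K. \<pi> x \<in> X} \<union> {x\<in>K. \<pi> x \<in> Y} = {x\<in>K. \<pi> x \<in> X \<union> Y}" by auto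
    ultimately show ?case by simp
  qed
  from this[OF B] have "td_le {x\<in>K. \<pi> x \<in> B} (a + b)" by simp
  moreover have "{x\<in>K. \<pi> x \<in> B} = K" using \<pi> by (auto simp: retraction_def)
  ultimately show ?thesis by simp
qed

text \<open>An edge leaving the fibre has both ends in \<open>B\<close>, and the fibre meets
  \<open>B\<close> only in \<open>\<pi> x\<close>. So a walk from \<open>x\<close> to
  \<open>\<pi> x\<close> cannot leave the fibre before it arrives.\<close>

lemma retraction_fiber:
  assumes \<pi>: "retraction K B \<pi>" and "conn K" "x \<in> K"
  shows "reach {y\<in>K. \<pi> y = \<pi> x} x (\<pi> x)"
proof (rule ccontr)
  let ?F = "{y\<in>K. \<pi> y = \<pi> x}"
  assume not: "\<not> reach ?F x (\<pi> x)"
  have "\<pi> x \<in> K" "\<pi> (\<pi> x) = \<pi> x" using \<pi> assms(3) by (auto simp: retraction_def)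
  then have "reach K x (\<pi> x)" using assms by (auto simp: conn_def)
  moreover have "\<pi> x \<notin> component ?F x" using not by (simp add: component_def)
  ultimately obtain a b where ab: "a \<in> component ?F x" "b \<in> K" "b \<notin> component ?F x" "adj a b"
    by (rule reach_exit[OF _ component_self])
  have aF: "a \<in> ?F" using component_subset[of x ?F] ab(1) assms(3) by auto
  then have "b \<notin> ?F" using component_closed[OF ab(1) _ _ ab(4)] ab assms(3) by auto
  then have "a \<in> B" using retraction_adj[OF \<pi>, of a b] ab aF by auto
  then have "a = \<pi> x" using retraction_id[OF \<pi>, of a] aF by simp
  then show False using ab(1) not by (simp add: component_def)
qed

text \<open>The image of a walk simply pauses where \<open>f\<close> identifies adjacent
  vertices.\<close>

lemma reach_map:
  assumes "reach X x y"
    and "\<And>a. a \<in> X \<Longrightarrow> f a \<in> Y"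
    and "\<And>a b. a \<in> X \<Longrightarrow> b \<in> X \<Longrightarrow> adj a b \<Longrightarrow> f a \<noteq> f b \<Longrightarrow> adj (f a) (f b)"
  shows "reach Y (f x) (f y)"
  using assms(1)
proof (induction rule: reach_induct)
  case (step y z)
  then show ?case using assms(2,3) by (cases "f y = f z") (auto intro: reach_step)
qed simp

lemma retraction_conn:
  assumes \<pi>: "retraction K B \<pi>" and "conn K"
  shows "conn B"
  unfolding conn_def
proof (intro ballI)
  fix x y assume xy: "x \<in> B" "y \<in> B"
  then have "reach K x y" using retraction_subset[OF \<pi>] assms(2) unfolding conn_def by blast
  moreover have "adj (\<pi> a) (\<pi> b)" if "a \<in> K" "b \<in> K" "adj a b" "\<pi> a \<noteq> \<pi> b" for a b
  proof -
    have "a \<in> B" "b \<in> B" using retraction_adj[OF \<pi> that] by blast+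
    then show ?thesis using that(3) by (simp only: retraction_id[OF \<pi>])
  qed
  ultimately have "reach B (\<pi> x) (\<pi> y)"
    using reach_map[of K x y \<pi> B] retraction_in[OF \<pi>] by blast
  then show "reach B x y" by (simp only: retraction_id[OF \<pi>] xy)
qed

section \<open>Long paths between two sets\<close>

text \<open>
  For \<open>U = W \<union> S\<close> this is what 2-connectedness demands of \<open>K\<close>: joining a new vertex
  \<open>u\<close> to \<open>W\<close>, a new vertex \<open>v\<close> to \<open>S\<close>, and \<open>u\<close> to \<open>v\<close> leaves no cutvertex
  inside \<open>K\<close>.
\<close>
definition guarded :: "'a set \<Rightarrow> 'a set \<Rightarrow> bool" where
  "guarded K U \<longleftrightarrow> (\<forall>x\<in>K. \<forall>y\<in>K - {x}. \<exists>z\<in>U \<inter> (K - {x}). reach (K - {x}) y z)"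

text \<open>\<open>W\<close> and \<open>S\<close> are not restricted to subsets of \<open>K\<close>,
  so that neighbourhoods such as \<open>{a. adj b a}\<close> can be inserted directly. They may
  overlap, and the path may be a single vertex.\<close>

definition linking :: "'a set \<Rightarrow> bool" where
  "linking K \<longleftrightarrow> (\<forall>W S. conn K \<longrightarrow> W \<inter> K \<noteq> {} \<longrightarrow> S \<inter> K \<noteq> {} \<longrightarrow> guarded K (W \<union> S) \<longrightarrow>
    (\<exists>p. vpath K p \<and> hd p \<in> W \<and> last p \<in> S \<and> td_le K (length p)))"

lemma linkingE:
  assumes "linking K" "conn K" "W \<inter> K \<noteq> {}" "S \<inter> K \<noteq> {}" "guarded K (W \<union> S)"
  obtains p where "vpath K p" "hd p \<in> W" "last p \<in> S" "td_le K (length p)"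
  using assms unfolding linking_def by metis

text \<open>Serves the blocks inside the induction and finally the whole graph. The ends
  \<open>b\<close> and \<open>c\<close> pay for the two vertices deleted before passing to a
  component. A single edge also counts as a block and is treated separately.\<close>

lemma long_path_of_two_connected:
  assumes fin: "finite B" and conn: "conn B" and conn': "\<forall>d\<in>B. conn (B - {d})"
    and bc: "b \<in> B" "c \<in> B" "b \<noteq> c" and IH: "\<forall>L. L \<subset> B \<longrightarrow> linking L"
  obtains p where "vpath B p" "hd p = b" "last p = c" "td_le B (length p)"
    "B \<noteq> {b, c} \<Longrightarrow> 3 \<le> length p"
proof (cases "B = {b, c}")
  case True
  have "reach B b c" using conn bc by (simp add: conn_def)
  then obtain a a' where "a \<in> {b}" "a \<in> B" "a' \<in> B" "a' \<notin> {b}" "adj a a'"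
    using bc by (auto elim: reach_exit)
  then have "adj b c" using True by auto
  moreover have "td_le B 2"
  proof -
    have "B - {b} - {c} = {}" using True by blast
    then have "td_le (B - {b} - {c}) 0" by (simp only: td_le.empty)
    then show ?thesis using td_le_remove numeral_2_eq_2 by metis
  qed
  ultimately show thesis using True bc by (intro that[of "[b, c]"]) (auto simp: vpath_def numeral_2_eq_2)
next
  case False
  define X where "X = B - {b, c}"
  have "X \<noteq> {}" "finite X" using False fin bc by (auto simp: X_def)
  then obtain x where x: "x \<in> X" and dom: "\<forall>n. td_le (component X x) n \<longrightarrow> td_le X n"
    by (elim dominating_component)
  define L where "L = component X x"
  have L: "L \<subseteq> X" "x \<in> L" "conn L" using component_subset[OF x] conn_component[OF x] by (simp_all add: L_def)
  have closed: "a' \<in> L" if "a \<in> L" "adj a a'" "a' \<in> X" for a a'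
    using that component_closed[of a X x a'] x by (simp add: L_def)
  \<comment> \<open>The equation covers both orders of \<open>b\<close> and \<open>c\<close>. As
    \<open>B - {e}\<close> is connected, some walk from \<open>x\<close> to \<open>d\<close> avoids
    \<open>e\<close>; the edge by which it leaves \<open>L\<close> must end in
    \<open>d\<close>.\<close>
  have nbr: "{a. adj d a} \<inter> L \<noteq> {}" if d: "{d, e} = {b, c}" for d e
  proof -
    have "d \<in> B" "e \<in> B" "d \<noteq> e" "x \<in> B - {e}"
      using d bc x by (auto simp: doubleton_eq_iff X_def)
    then have "reach (B - {e}) x d" using bspec[OF conn', of e] by (simp add: conn_def)
    moreover have "d \<notin> L" using L(1) d by (auto simp: X_def)
    ultimately obtain a a' where a: "a \<in> L" "a' \<in> B - {e}" "a' \<notin> L" "adj a a'"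
      by (rule reach_exit[OF _ L(2)])
    then have "a' = d" using closed[of a a'] d by (auto simp: X_def)
    then show ?thesis using a adj_sym by blast
  qed
  have "guarded L ({a. adj b a} \<union> {a. adj c a})"
    unfolding guarded_def
  proof (intro ballI)
    fix v y assume v: "v \<in> L" and y: "y \<in> L - {v}"
    let ?D = "component (L - {v}) y"
    have D: "?D \<subseteq> L - {v}" using component_subset[OF y] .
    \<comment> \<open>A walk to \<open>b\<close> avoiding \<open>v\<close> leaves \<open>?D\<close>
      by an edge that also leaves \<open>L\<close>, hence ends in \<open>b\<close> or
      \<open>c\<close>.\<close>
    have "reach (B - {v}) y b"
      using bspec[OF conn', of v] v y L(1) bc unfolding conn_def X_def by blast
    moreover have "b \<notin> ?D" using D L(1) by (auto simp: X_def)
    ultimately obtain a a' where a: "a \<in> ?D" "a' \<in> B - {v}" "a' \<notin> ?D" "adj a a'"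
      by (rule reach_exit[OF _ component_self])
    have "a' \<notin> L" using component_closed[OF a(1) y _ a(4)] a by blast
    then have "a' \<in> {b, c}" using closed[of a a'] a D by (auto simp: X_def)
    then have "a \<in> {a. adj b a} \<union> {a. adj c a}" using a(4) adj_sym by auto
    then show "\<exists>z\<in>({a. adj b a} \<union> {a. adj c a}) \<inter> (L - {v}). reach (L - {v}) y z"
      using a(1) D by (auto simp: component_def)
  qed
  moreover have "linking L" using IH L bc by (auto simp: X_def)
  ultimately obtain p where p: "vpath L p" "hd p \<in> {a. adj b a}" "last p \<in> {a. adj c a}"
      "td_le L (length p)"
    by (elim linkingE[OF _ L(3) nbr[of b c] nbr[of c b]]) auto
  have "td_le X (length p)" using dom p(4) L_def by simp
  moreover have "B - {b} - {c} = X" by (auto simp: X_def)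
  ultimately have "td_le B (Suc (Suc (length p)))" by (metis td_le_remove)
  moreover have "vpath B (b # p @ [c])"
    using p L bc adj_sym by (auto simp: vpath_def X_def successively_Cons successively_append_iff)
  moreover have "p \<noteq> []" using p(1) by (simp add: vpath_def)
  ultimately show thesis by (intro that[of "b # p @ [c]"]) (auto simp: Suc_le_eq)
qed

text \<open>Applied to components at a separating vertex and to parts hanging off a block. As
  \<open>L\<close> can be left only through \<open>c\<close>, it is guarded by \<open>U\<close> and
  the neighbours of \<open>c\<close>, so \<open>linking L\<close> applies to these two sets.\<close>

lemma long_path_in_hanging_part:
  assumes "conn K" and U: "guarded K U" and c: "c \<in> K" "c \<notin> L" and L: "L \<subseteq> K" "conn L" "L \<noteq> {}"
    and hang: "\<forall>a\<in>L. \<forall>b\<in>K - L. adj a b \<longrightarrow> b = c" and "linking L"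
  obtains p where "vpath L p" "hd p \<in> U" "adj (last p) c" "td_le L (length p)"
proof -
  obtain x where x: "x \<in> L" using L by blast
  have "reach K x c" using assms x by (auto simp: conn_def)
  then obtain a b where "a \<in> L" "b \<in> K" "b \<notin> L" "adj a b"
    using reach_exit[of K x c L] x c by blast
  then have c_nbr: "{a. adj a c} \<inter> L \<noteq> {}" using hang by blast
  \<comment> \<open>Guardedness at \<open>c\<close> itself shows that \<open>U\<close> meets
    \<open>L\<close>: a walk avoiding \<open>c\<close> cannot leave \<open>L\<close>.\<close>
  obtain z where z: "z \<in> U" "reach (K - {c}) x z"
    using U c x L unfolding guarded_def by blast
  have "z \<in> L"
  proof (rule ccontr)
    assume "z \<notin> L"
    then obtain a b where "a \<in> L" "b \<in> K - {c}" "b \<notin> L" "adj a b"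
      using reach_exit[OF z(2) x] by blast
    then show False using hang by blast
  qed
  then have "U \<inter> L \<noteq> {}" using z by blast
  moreover have "guarded L (U \<union> {a. adj a c})"
    unfolding guarded_def
  proof (intro ballI)
    fix v y assume v: "v \<in> L" and y: "y \<in> L - {v}"
    let ?D = "component (L - {v}) y"
    have D: "?D \<subseteq> L - {v}" using component_subset[OF y] .
    obtain z where z: "z \<in> U" "reach (K - {v}) y z"
      using U v y L unfolding guarded_def by blast
    have "\<exists>z\<in>(U \<union> {a. adj a c}) \<inter> ?D. True"
    proof (cases "z \<in> ?D")
      case False
      then obtain a b where a: "a \<in> ?D" "b \<in> K - {v}" "b \<notin> ?D" "adj a b"
        using reach_exit[OF z(2) component_self] by blast
      have "b \<notin> L" using component_closed[OF a(1) y _ a(4)] a by blast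
      then have "b = c" using hang a D by blast
      then show ?thesis using a by blast
    qed (use z in blast)
    then show "\<exists>z\<in>(U \<union> {a. adj a c}) \<inter> (L - {v}). reach (L - {v}) y z"
      using D by (auto simp: component_def)
  qed
  ultimately show thesis
    using linkingE[OF \<open>linking L\<close> L(2) _ c_nbr, of U] that by blast
qed

lemma vpath_from_tl: "vpath X p \<Longrightarrow> a \<in> set (tl p) \<Longrightarrow> reach (X - {hd p}) a (last p)"
proof (cases p)
  case (Cons x q)
  assume "vpath X p" "a \<in> set (tl p)"
  then have "q \<noteq> []" "vpath (X - {x}) q" "a \<in> set q"
    using Cons by (auto simp: vpath_def successively_Cons)
  then show ?thesis using vpath_reach Cons by auto
qed simp

lemma long_path_through_separator:
  assumes fin: "finite K" and conn: "conn K" and W: "W \<inter> K \<noteq> {}" and S: "S \<inter> K \<noteq> {}"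
    and guard: "guarded K (W \<union> S)" and c: "c \<in> K"
    and sep: "\<forall>w\<in>W \<inter> (K - {c}). \<forall>s\<in>S \<inter> (K - {c}). \<not> reach (K - {c}) w s"
    and IH: "\<forall>L. L \<subset> K \<longrightarrow> linking L"
  obtains p where "vpath K p" "hd p \<in> W" "last p \<in> S" "td_le K (length p)"
proof (cases "K = {c}")
  case True
  then have "c \<in> W" "c \<in> S" using W S by auto
  moreover have "td_le K (length [c])"
    using True by (auto intro!: td_le_remove[of _ c] td_le.empty)
  ultimately show thesis using True by (intro that[of "[c]"]) (auto simp: vpath_def)
next
  case False
  let ?X = "K - {c}"
  have "?X \<noteq> {}" "finite ?X" using False fin c by auto
  then obtain x where x: "x \<in> ?X" and dom: "\<forall>n. td_le (component ?X x) n \<longrightarrow> td_le ?X n"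
    by (elim dominating_component)
  define L where "L = component ?X x"
  have L: "L \<subseteq> ?X" "x \<in> L" "conn L"
    using component_subset[OF x] conn_component[OF x] by (simp_all add: L_def)
  have hang: "\<forall>a\<in>L. \<forall>b\<in>K - L. adj a b \<longrightarrow> b = c"
  proof (intro ballI impI)
    fix a b assume "a \<in> L" "b \<in> K - L" "adj a b"
    then show "b = c" using component_closed[of a ?X x b] x by (auto simp: L_def)
  qed
  have hyps: "c \<notin> L" "L \<subseteq> K" "L \<noteq> {}" "linking L" using IH L c by blast+
  obtain p where p: "vpath L p" "hd p \<in> W \<union> S" "adj (last p) c" "td_le L (length p)"
    by (rule long_path_in_hanging_part[OF conn guard c hyps(1,2) L(3) hyps(3) hang hyps(4)])
  have td: "td_le K (Suc (length p))" using p(4) dom L_def td_le_remove by blast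
  have hd_p: "hd p \<in> L" using p(1) hd_in_set by (auto simp: vpath_def)
  \<comment> \<open>\<open>T\<close> is whichever of \<open>W\<close> and \<open>S\<close> is not
    met from \<open>hd p\<close> without \<open>c\<close>. A path \<open>q\<close> from
    \<open>c\<close> to \<open>T\<close>, possibly \<open>c\<close> alone, then misses
    \<open>L\<close>, because its vertices after \<open>c\<close> reach \<open>T\<close> in
    \<open>K - {c}\<close>. It adds at least one vertex, paying for the deletion of
    \<open>c\<close>.\<close>
  have ext: "\<exists>q. vpath K q \<and> hd q = hd p \<and> last q \<in> T \<and> Suc (length p) \<le> length q"
    if T: "T \<inter> K \<noteq> {}" and avoid: "\<And>t. t \<in> T \<inter> ?X \<Longrightarrow> \<not> reach ?X (hd p) t" for T
  proof -
    obtain t where t: "t \<in> T" "t \<in> K" using T by blast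
    then have "reach K c t" using conn c by (auto simp: conn_def)
    then obtain q where q: "vpath K q" "hd q = c" "last q = t" using c reach_imp_vpath by blast
    have "a \<notin> L" if "a \<in> set q" for a
    proof
      assume "a \<in> L"
      then have "a \<noteq> c" using L by blast
      then have a: "a \<in> set (tl q)" using that q by (cases q) auto
      then have "reach ?X a t" using vpath_from_tl[OF q(1)] q by simp
      moreover have "reach ?X (hd p) a"
        using L(3) \<open>a \<in> L\<close> hd_p L(1) reach_mono unfolding conn_def by blast
      ultimately have "reach ?X (hd p) t" by (rule reach_trans[rotated])
      moreover have "t \<in> ?X" using calculation reach_in hd_p L(1) by blast
      ultimately show False using avoid t by blast
    qed
    moreover have "set p \<subseteq> L" "p \<noteq> []" "q \<noteq> []" using p(1) q(1) by (auto simp: vpath_def)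
    ultimately have "vpath K (p @ q)"
      using vpath_append[of K p q] vpath_mono[OF p(1), of K] L q p(3) by auto
    then show ?thesis using q t \<open>p \<noteq> []\<close> \<open>q \<noteq> []\<close>
      by (intro exI[of _ "p @ q"]) (auto simp: Suc_le_eq)
  qed
  show thesis
  proof (cases "hd p \<in> W")
    case True
    then obtain q where "vpath K q" "hd q = hd p" "last q \<in> S" "Suc (length p) \<le> length q"
      using ext[OF S] sep hd_p L by blast
    then show thesis using that[of q] True td_le_mono td by metis
  next
    case False
    then have "hd p \<in> S" using p by blast
    then obtain q where "vpath K q" "hd q = hd p" "last q \<in> W" "Suc (length p) \<le> length q"
      using ext[OF W] sep reach_sym hd_p L by blast
    then show thesis
      using that[of "rev q"] \<open>hd p \<in> S\<close> td_le_mono[OF _ td] vpath_rev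
      by (auto simp: hd_rev last_rev)
  qed
qed

text \<open>The block is found as a smallest retract seeing both sets from each of its vertices.\<close>
lemma exists_block:
  assumes fin: "finite K"
    and nonsep: "\<forall>d\<in>K. \<exists>w\<in>W \<inter> K. \<exists>s\<in>S \<inter> K. w \<noteq> d \<and> s \<noteq> d \<and> reach (K - {d}) w s"
  obtains B \<pi> where "retraction K B \<pi>" "\<forall>d\<in>B. conn (B - {d})"
    "\<forall>d\<in>B. \<exists>w\<in>W \<inter> K. \<exists>s\<in>S \<inter> K. \<pi> w \<noteq> d \<and> \<pi> s \<noteq> d"
proof -
  \<comment> \<open>The walk between the images in \<open>B - {d}\<close> is required as well: it
    shows which component to keep when shrinking \<open>B\<close>.\<close>
  define P where "P B \<pi> \<longleftrightarrow> retraction K B \<pi> \<and>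
    (\<forall>d\<in>B. \<exists>w\<in>W \<inter> K. \<exists>s\<in>S \<inter> K. \<pi> w \<noteq> d \<and> \<pi> s \<noteq> d \<and> reach (B - {d}) (\<pi> w) (\<pi> s))" for B \<pi>
  have "P K id" using assms by (auto simp: P_def retraction_def)
  then have "\<exists>n B \<pi>. P B \<pi> \<and> card B = n" by blast
  then obtain B \<pi> where P: "P B \<pi>" and least: "\<And>B' \<pi>'. P B' \<pi>' \<Longrightarrow> card B \<le> card B'"
    using exists_least_iff[of "\<lambda>n. \<exists>B \<pi>. P B \<pi> \<and> card B = n"] by (metis not_le)
  have \<pi>: "retraction K B \<pi>" using P by (simp add: P_def)
  have conn': "conn (B - {d})" if d: "d \<in> B" for d
  proof (rule ccontr)
    assume not_conn: "\<not> conn (B - {d})"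
    obtain w s where ws: "w \<in> W \<inter> K" "s \<in> S \<inter> K" "\<pi> w \<noteq> d" "\<pi> s \<noteq> d"
        "reach (B - {d}) (\<pi> w) (\<pi> s)"
      using P d unfolding P_def by blast
    define C where "C = component (B - {d}) (\<pi> w)"
    have \<pi>w: "\<pi> w \<in> B - {d}" using ws retraction_in[OF \<pi>] by blast
    have C: "C \<subseteq> B - {d}" "conn C"
      using component_subset[OF \<pi>w] conn_component[OF \<pi>w] by (simp_all add: C_def)
    \<comment> \<open>Keep the component \<open>C\<close> containing both images and fold the rest
      of \<open>B\<close> onto \<open>d\<close>. The retract \<open>insert d C\<close> again
      satisfies \<open>P\<close>, so by minimality it is all of \<open>B\<close>, and
      \<open>B - {d} = C\<close> is connected after all.\<close>
    define \<rho> where "\<rho> x = (if x \<in> C then x else d)" for x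
    have \<rho>_adj: "x \<in> insert d C \<and> y \<in> insert d C" if "x \<in> B" "y \<in> B" "adj x y" "\<rho> x \<noteq> \<rho> y" for x y
    proof (rule ccontr)
      assume not: "\<not> ?thesis"
      have closed: "v \<in> insert d C" if "u \<in> C" "v \<in> B" "adj u v" for u v
        using that component_closed[OF _ \<pi>w, of u v] by (auto simp: C_def)
      show False using that not closed[of x y] closed[of y x] adj_sym[of x y]
        by (auto simp: \<rho>_def split: if_splits)
    qed
    have \<rho>_id: "\<rho> x = x" if "x \<in> insert d C" for x using that by (auto simp: \<rho>_def)
    have "P (insert d C) (\<rho> \<circ> \<pi>)"
      unfolding P_def
    proof (intro conjI ballI)
      show "retraction K (insert d C) (\<rho> \<circ> \<pi>)"
        unfolding retraction_def
      proof (intro conjI ballI impI)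
        show "insert d C \<subseteq> K" using C d retraction_subset[OF \<pi>] by blast
        show "(\<rho> \<circ> \<pi>) ` K \<subseteq> insert d C" by (auto simp: \<rho>_def)
        show "(\<rho> \<circ> \<pi>) b = b" if "b \<in> insert d C" for b
          using that \<rho>_id retraction_id[OF \<pi>, of b] C d by auto
        fix x y assume xy: "x \<in> K" "y \<in> K" "adj x y" and neq: "(\<rho> \<circ> \<pi>) x \<noteq> (\<rho> \<circ> \<pi>) y"
        have "x \<in> B \<and> y \<in> B" using retraction_adj[OF \<pi> xy] neq by fastforce
        moreover from this have "\<rho> x \<noteq> \<rho> y" using neq retraction_id[OF \<pi>] by simp
        ultimately show "x \<in> insert d C" "y \<in> insert d C" using \<rho>_adj xy by blast+
      qed
    next
      fix e assume e: "e \<in> insert d C"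
      show "\<exists>w\<in>W \<inter> K. \<exists>s\<in>S \<inter> K. (\<rho> \<circ> \<pi>) w \<noteq> e \<and> (\<rho> \<circ> \<pi>) s \<noteq> e \<and>
          reach (insert d C - {e}) ((\<rho> \<circ> \<pi>) w) ((\<rho> \<circ> \<pi>) s)"
      proof (cases "e = d")
        case True
        have in_C: "\<pi> w \<in> C" "\<pi> s \<in> C" using ws(5) by (simp_all add: C_def component_def)
        then have "reach C (\<pi> w) (\<pi> s)" using C by (simp add: conn_def)
        then have "reach (insert d C - {e}) (\<pi> w) (\<pi> s)" by (rule reach_mono) (use C True in auto)
        then show ?thesis
          using ws in_C \<rho>_id True by (intro bexI[OF _ ws(1)] bexI[OF _ ws(2)]) auto
      next
        case False
        then have eC: "e \<in> C" using e by simp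
        then obtain w s where ws: "w \<in> W \<inter> K" "s \<in> S \<inter> K" "\<pi> w \<noteq> e" "\<pi> s \<noteq> e"
            "reach (B - {e}) (\<pi> w) (\<pi> s)"
          using P C unfolding P_def by blast
        \<comment> \<open>Folding sends no other vertex to \<open>e\<close>, so the walk avoiding
          \<open>e\<close> in \<open>B\<close> survives it.\<close>
        have neq: "\<rho> x \<noteq> e" if "x \<noteq> e" for x using that False by (auto simp: \<rho>_def)
        have "reach (insert d C - {e}) (\<rho> (\<pi> w)) (\<rho> (\<pi> s))"
          using ws(5)
        proof (rule reach_map[where f = \<rho>])
          show "\<rho> a \<in> insert d C - {e}" if "a \<in> B - {e}" for a
            using that neq by (auto simp: \<rho>_def)
          show "adj (\<rho> a) (\<rho> b)" if "a \<in> B - {e}" "b \<in> B - {e}" "adj a b" "\<rho> a \<noteq> \<rho> b" for a b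
            using \<rho>_adj[of a b] that \<rho>_id by simp
        qed
        then show ?thesis using ws neq by (intro bexI[OF _ ws(1)] bexI[OF _ ws(2)]) auto
      qed
    qed
    then have "card B \<le> card (insert d C)" by (rule least)
    moreover have "finite B" using retraction_subset[OF \<pi>] fin finite_subset by blast
    ultimately have "insert d C = B"
      using card_seteq[of B "insert d C"] C d by blast
    then have "B - {d} = C" using C by blast
    then show False using not_conn C by simp
  qed
  show thesis
    by (rule that[of B \<pi>]) (use P conn' in \<open>auto simp: P_def\<close>)
qed

lemma long_path_through_block:
  assumes fin: "finite K" and conn: "conn K" and W: "W \<inter> K \<noteq> {}" and S: "S \<inter> K \<noteq> {}"
    and guard: "guarded K (W \<union> S)"
    and nonsep: "\<forall>d\<in>K. \<exists>w\<in>W \<inter> K. \<exists>s\<in>S \<inter> K. w \<noteq> d \<and> s \<noteq> d \<and> reach (K - {d}) w s"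
    and IH: "\<forall>L. L \<subset> K \<longrightarrow> linking L"
  obtains p where "vpath K p" "hd p \<in> W" "last p \<in> S" "td_le K (length p)"
proof -
  obtain B \<pi> where \<pi>: "retraction K B \<pi>" and conn': "\<forall>d\<in>B. conn (B - {d})"
    and colours: "\<forall>d\<in>B. \<exists>w\<in>W \<inter> K. \<exists>s\<in>S \<inter> K. \<pi> w \<noteq> d \<and> \<pi> s \<noteq> d"
    by (rule exists_block[OF fin nonsep])
  note B = retraction_subset[OF \<pi>] retraction_conn[OF \<pi> conn]
  have finB: "finite B" using B fin finite_subset by blast
  have block_path: "\<exists>p. vpath B p \<and> hd p = b \<and> last p = c \<and> td_le B (length p)"
    if "b \<in> B" "c \<in> B" "b \<noteq> c" for b c
  proof -
    have "\<forall>L. L \<subset> B \<longrightarrow> linking L" using IH B(1) by blast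
    from long_path_of_two_connected[OF finB B(2) conn' that this] show ?thesis by blast
  qed
  show thesis
  proof (cases "K = B")
    case True
    obtain w where w: "w \<in> W" "w \<in> B" using W True by blast
    \<comment> \<open>\<open>colours\<close> at \<open>d = w\<close> makes the two ends distinct,
      since here \<open>\<pi>\<close> is the identity on \<open>K\<close>.\<close>
    obtain s where "s \<in> S" "s \<in> B" "w \<noteq> s"
      using bspec[OF colours w(2)] retraction_id[OF \<pi>] True by blast
    then show thesis using block_path[OF w(2)] that w True by metis
  next
    case False
    let ?X = "K - B"
    have "?X \<noteq> {}" "finite ?X" using False fin B by auto
    then obtain x where x: "x \<in> ?X" and dom: "\<forall>n. td_le (component ?X x) n \<longrightarrow> td_le ?X n"
      by (elim dominating_component)
    define L where "L = component ?X x"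
    define c where "c = \<pi> x"
    have c: "c \<in> B" using x retraction_in[OF \<pi>] by (simp add: c_def)
    have L: "L \<subseteq> ?X" "x \<in> L" "conn L"
      using component_subset[OF x] conn_component[OF x] by (simp_all add: L_def)
    \<comment> \<open>Edges outside \<open>B\<close> do not change \<open>\<pi>\<close>, so all of
      \<open>L\<close> hangs at \<open>c\<close>.\<close>
    have \<pi>_L: "\<pi> a = c" if "a \<in> L" for a
    proof -
      have "reach ?X x a" using that by (simp add: L_def component_def)
      then show ?thesis
      proof (induction rule: reach_induct)
        case (step y z)
        then have "\<pi> z = \<pi> y" using retraction_adj[OF \<pi>, of y z] by (metis DiffE)
        with step show ?case by simp
      qed (simp add: c_def)
    qed
    have hang: "\<forall>a\<in>L. \<forall>b\<in>K - L. adj a b \<longrightarrow> b = c"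
    proof (intro ballI impI)
      fix a b assume that: "a \<in> L" "b \<in> K - L" "adj a b"
      have "b \<in> B" using that component_closed[of a ?X x b] x by (auto simp: L_def)
      moreover have "\<pi> b = \<pi> a" using retraction_adj[OF \<pi>, of a b] that L(1) by (metis DiffE subsetD)
      ultimately show "b = c" using \<pi>_L that retraction_id[OF \<pi>] by simp
    qed
    have hyps: "c \<in> K" "c \<notin> L" "L \<subseteq> K" "L \<noteq> {}" "linking L" using IH L c B by blast+
    obtain p where p: "vpath L p" "hd p \<in> W \<union> S" "adj (last p) c" "td_le L (length p)"
      by (rule long_path_in_hanging_part[OF conn guard hyps(1-3) L(3) hyps(4) hang hyps(5)])
    \<comment> \<open>Stated for one target \<open>t\<close>, as \<open>p\<close> may start in
      \<open>W\<close> or in \<open>S\<close>. The path runs through \<open>L\<close> to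
      \<open>c\<close>, through the block to \<open>\<pi> t\<close>, and inside the fibre of
      \<open>\<pi> t\<close> to \<open>t\<close>.\<close>
    have ext: "\<exists>q. vpath K q \<and> hd q = hd p \<and> last q = t \<and> td_le K (length q)"
      if t: "t \<in> K" "\<pi> t \<noteq> c" for t
    proof -
      define b where "b = \<pi> t"
      have b: "b \<in> B" "\<pi> b = b" using t retraction_in[OF \<pi>] retraction_id[OF \<pi>] by (auto simp: b_def)
      obtain q where q: "vpath B q" "hd q = c" "last q = b" "td_le B (length q)"
        using block_path[OF c b(1)] t by (auto simp: b_def)
      let ?F = "{y\<in>K. \<pi> y = b}"
      have "reach ?F b t" using reach_sym[OF retraction_fiber[OF \<pi> conn t(1)]] by (simp add: b_def)
      moreover have "b \<in> ?F" using b B by blast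
      ultimately obtain r where r: "vpath ?F r" "hd r = b" "last r = t"
        using reach_imp_vpath by blast
      have ne: "p \<noteq> []" "q \<noteq> []" "r \<noteq> []" using p(1) q(1) r(1) by (auto simp: vpath_def)
      \<comment> \<open>\<open>q\<close> already ends in \<open>b\<close>. What remains of
        \<open>r\<close> avoids \<open>B\<close>, which meets the fibre only in \<open>b\<close>,
        and avoids \<open>L\<close>, which lies in the fibre of \<open>c\<close>.\<close>
      obtain r' where r': "r = b # r'" using r ne by (cases r) auto
      have "vpath K p" "vpath K q" using vpath_mono p(1) q(1) L B by blast+
      moreover have pq: "set p \<inter> set q = {}" using p(1) q(1) L by (auto simp: vpath_def)
      ultimately have pq_path: "vpath K (p @ q)" using vpath_append p(3) q(2) by metis
      have "vpath K (p @ q @ r')"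
      proof (cases "r' = []")
        case False
        have "vpath K r'" "adj b (hd r')"
          using r(1) r' False by (auto simp: vpath_def successively_Cons)
        moreover have "set (p @ q) \<inter> set r' = {}"
        proof -
          have "a \<notin> set (p @ q)" if a: "a \<in> set r'" for a
          proof
            assume "a \<in> set (p @ q)"
            then consider "a \<in> L" | "a \<in> B" using p(1) q(1) by (auto simp: vpath_def)
            moreover have "\<pi> a = b" "a \<noteq> b" using a r(1) r' by (auto simp: vpath_def)
            ultimately show False
              using \<pi>_L[of a] retraction_id[OF \<pi>, of a] t by cases (auto simp: b_def)
          qed
          then show ?thesis by blast
        qed
        ultimately show ?thesis using vpath_append[OF pq_path, of r'] q(3) ne by simp
      qed (use pq_path in simp)
      moreover have "last (p @ q @ r') = t" using r r' q(3) ne by auto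
      moreover have "td_le K (length (p @ q @ r'))"
      proof -
        \<comment> \<open>\<open>q\<close> pays for \<open>B\<close> and \<open>p\<close> for
          \<open>K - B\<close>; \<open>r'\<close> only lengthens the path.\<close>
        have "td_le K (length q + length p)"
          using td_le_retraction[OF \<pi> q(4)] dom p(4) L_def by blast
        then show ?thesis by (rule td_le_mono[rotated]) simp
      qed
      ultimately show ?thesis using ne by (intro exI[of _ "p @ q @ r'"]) auto
    qed
    obtain w s where "w \<in> W" "w \<in> K" "s \<in> S" "s \<in> K" "\<pi> w \<noteq> c" "\<pi> s \<noteq> c"
      using bspec[OF colours c] by blast
    then obtain q r where "vpath K q" "hd q = hd p" "last q \<in> W" "td_le K (length q)"
      and "vpath K r" "hd r = hd p" "last r \<in> S" "td_le K (length r)"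
      using ext by metis
    then show thesis
      using p(2) that[of r] that[of "rev q"] vpath_rev by (auto simp: hd_rev last_rev)
  qed
qed

lemma linking_finite: "finite K \<Longrightarrow> linking K"
proof (induction K rule: finite_psubset_induct)
  case (psubset K)
  then have IH: "\<forall>L. L \<subset> K \<longrightarrow> linking L" by blast
  show ?case
    unfolding linking_def
  proof (intro allI impI)
    fix W S assume *: "conn K" "W \<inter> K \<noteq> {}" "S \<inter> K \<noteq> {}" "guarded K (W \<union> S)"
    show "\<exists>p. vpath K p \<and> hd p \<in> W \<and> last p \<in> S \<and> td_le K (length p)"
    proof (cases "\<forall>d\<in>K. \<exists>w\<in>W \<inter> K. \<exists>s\<in>S \<inter> K. w \<noteq> d \<and> s \<noteq> d \<and> reach (K - {d}) w s")
      case True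
      show ?thesis
        by (rule long_path_through_block[OF psubset.hyps * True IH]) blast
    next
      case False
      then obtain c where c: "c \<in> K" and nr: "\<not> (\<exists>w\<in>W \<inter> K. \<exists>s\<in>S \<inter> K.
          w \<noteq> c \<and> s \<noteq> c \<and> reach (K - {c}) w s)"
        by (metis (no_types))
      then have sep: "\<forall>w\<in>W \<inter> (K - {c}). \<forall>s\<in>S \<inter> (K - {c}). \<not> reach (K - {c}) w s"
        by blast
      show ?thesis
        by (rule long_path_through_separator[OF psubset.hyps * c sep IH]) blast
    qed
  qed
qed

end

section \<open>Elimination forests from ancestor lists\<close>

text \<open>
  A rooted forest on \<open>X\<close> is encoded by the map \<open>anc\<close> listing the ancestors of a vertex from its root
  down to itself.
\<close>
locale ancestor_lists =
  fixes X :: "'a set" and anc :: "'a \<Rightarrow> 'a list"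
  assumes anc_cases: "v \<in> X \<Longrightarrow> anc v = [v] \<or> (\<exists>u\<in>X. anc v = anc u @ [v])"
begin

definition tree_of :: "'a \<Rightarrow> 'a pair_pre_digraph" where
  "tree_of r = \<lparr>pverts = {v\<in>X. hd (anc v) = r},
    parcs = {(u, v). u \<in> X \<and> v \<in> X \<and> hd (anc u) = r \<and> anc v = anc u @ [v]}\<rparr>"

definition roots :: "'a set" where
  "roots = {r\<in>X. anc r = [r]}"

text \<open>Well-foundedness comes from the lists: that of a parent is shorter by one.\<close>

lemma anc_induct [consumes 1, case_names root child]:
  assumes "v \<in> X"
    and "\<And>v. v \<in> X \<Longrightarrow> anc v = [v] \<Longrightarrow> P v"
    and "\<And>u v. u \<in> X \<Longrightarrow> v \<in> X \<Longrightarrow> anc v = anc u @ [v] \<Longrightarrow> P u \<Longrightarrow> P v"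
  shows "P v"
  using assms(1)
proof (induction "length (anc v)" arbitrary: v rule: less_induct)
  case less
  then show ?case using anc_cases[OF less.prems] assms(2,3)
    by (metis length_append_singleton lessI)
qed

lemma anc_nonempty: "v \<in> X \<Longrightarrow> anc v \<noteq> []"
  using anc_cases by fastforce

lemma last_anc: "v \<in> X \<Longrightarrow> last (anc v) = v"
  using anc_cases by fastforce

lemma hd_anc_root: "v \<in> X \<Longrightarrow> hd (anc v) \<in> roots"
proof (induction rule: anc_induct)
  case (child u v)
  then show ?case using anc_nonempty by (simp add: hd_append)
qed (simp add: roots_def)

lemma wf_tree_of: "pair_wf_digraph (tree_of r)"
  by unfold_locales (auto simp: tree_of_def hd_append anc_nonempty)

lemma tree_arc:
  "u \<in> X \<Longrightarrow> v \<in> X \<Longrightarrow> anc v = anc u @ [v] \<Longrightarrow> (u, v) \<in> parcs (tree_of (hd (anc u)))"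
  by (simp add: tree_of_def)

lemma tree_arcD:
  "a \<in> parcs (tree_of r) \<Longrightarrow> fst a \<in> X \<and> anc (snd a) = anc (fst a) @ [snd a]"
  by (auto simp: tree_of_def)

text \<open>Each arc adds one entry to the list. This serves both the uniqueness of walks and the
  height bound.\<close>

lemma awalk_anc:
  assumes "pre_digraph.awalk (with_proj (tree_of r)) r p v"
  shows "length (anc v) = length (anc r) + length p"
proof -
  interpret T: pair_wf_digraph "tree_of r" by (rule wf_tree_of)
  have "length (anc v) = length (anc u) + length p"
    if "T.awalk u p v" for u
    using that
  proof (induction p arbitrary: u)
    case Nil
    then show ?case by (simp add: T.awalk_Nil_iff)
  next
    case (Cons e p)
    then have "e \<in> parcs (tree_of r)" "u = fst e" "T.awalk (snd e) p v"
      by (auto simp: T.awalk_Cons_iff)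
    then show ?case using Cons.IH by (cases e) (auto simp: tree_of_def)
  qed
  then show ?thesis using assms by simp
qed

lemma ex_awalk:
  assumes "v \<in> X"
  shows "\<exists>p. pre_digraph.awalk (with_proj (tree_of (hd (anc v)))) (hd (anc v)) p v"
  using assms
proof (induction rule: anc_induct)
  case (root v)
  interpret T: pair_wf_digraph "tree_of (hd (anc v))" by (rule wf_tree_of)
  have "v \<in> pverts (tree_of (hd (anc v)))" using root by (simp add: tree_of_def)
  then have "T.awalk v [] v" by (simp add: T.awalk_Nil_iff)
  then show ?case using root by auto
next
  case (child u v)
  interpret T: pair_wf_digraph "tree_of (hd (anc u))" by (rule wf_tree_of)
  from child obtain p where "T.awalk (hd (anc u)) p u" by blast
  moreover have "T.awalk u [(u, v)] v"
    using tree_arc[OF child(1-3)] T.arc_implies_awalk by fastforce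
  ultimately have "T.awalk (hd (anc u)) (p @ [(u, v)]) v" by (rule T.awalk_appendI)
  moreover have "hd (anc v) = hd (anc u)" using child anc_nonempty by simp
  ultimately show ?case by metis
qed

text \<open>The lengths agree by \<open>awalk_anc\<close>. Comparing from the end, the last arcs
  agree too: \<open>anc v\<close> without its last entry is the list of the parent and ends in the
  parent.\<close>

lemma awalk_unique:
  assumes "pre_digraph.awalk (with_proj (tree_of r)) r p v"
    and "pre_digraph.awalk (with_proj (tree_of r)) r q v"
  shows "p = q"
proof -
  interpret T: pair_wf_digraph "tree_of r" by (rule wf_tree_of)
  have "length p = length q" using awalk_anc[OF assms(1)] awalk_anc[OF assms(2)] by simp
  then show ?thesis using assms
  proof (induction p arbitrary: q v rule: rev_induct)
    case (snoc e p)
    then obtain f q' where q: "q = q' @ [f]" by (cases q rule: rev_cases) auto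
    have last_arc: "a \<in> parcs (tree_of r) \<and> snd a = v \<and> T.awalk r w (fst a)"
      if "T.awalk r (w @ [a]) v" for w a
      using that by (auto simp: T.awalk_Cons_iff T.awalk_Nil_iff)
    have e: "e \<in> parcs (tree_of r)" "snd e = v" "T.awalk r p (fst e)"
      using last_arc[of p e] snoc.prems(2) by blast+
    have f: "f \<in> parcs (tree_of r)" "snd f = v" "T.awalk r q' (fst f)"
      using last_arc[of q' f] snoc.prems(3) q by blast+
    have "anc (fst e) = anc (fst f)" "fst e \<in> X" "fst f \<in> X"
      using tree_arcD[OF e(1)] tree_arcD[OF f(1)] e(2) f(2) by simp_all
    then have "fst e = fst f" using last_anc by metis
    then have "e = f" using e f by (simp add: prod_eq_iff)
    moreover have "p = q'"
      using snoc.IH[of q' "fst e"] snoc.prems(1) q e(3) f(3) \<open>fst e = fst f\<close> by simp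
    ultimately show ?case using q by simp
  qed simp
qed

lemma rooted_tree_tree_of:
  assumes "r \<in> roots"
  shows "rooted_tree (tree_of r) r"
  unfolding rooted_tree_def
proof (intro conjI ballI)
  show "r \<in> pverts (tree_of r)" using assms by (simp add: roots_def tree_of_def)
  show "\<exists>!p. pre_digraph.awalk (with_proj (tree_of r)) r p v" if "v \<in> pverts (tree_of r)" for v
    using that ex_awalk[of v] awalk_unique by (auto simp: tree_of_def)
qed (rule wf_tree_of)

lemma reachable_anc:
  assumes "v \<in> X" "u \<in> set (anc v)"
  shows "u \<in> pverts (tree_of (hd (anc v))) \<and> u \<rightarrow>\<^sup>*\<^bsub>with_proj (tree_of (hd (anc v)))\<^esub> v"
  using assms
proof (induction rule: anc_induct)
  case (root v)
  interpret T: pair_wf_digraph "tree_of (hd (anc v))" by (rule wf_tree_of)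
  have "v \<in> pverts (tree_of (hd (anc v)))" using root by (simp add: tree_of_def)
  then show ?case using root T.reachable_refl[of v] by auto
next
  case (child w v)
  interpret T: pair_wf_digraph "tree_of (hd (anc w))" by (rule wf_tree_of)
  have eq: "hd (anc v) = hd (anc w)" using child anc_nonempty by simp
  have v: "v \<in> pverts (tree_of (hd (anc w)))" using child eq by (simp add: tree_of_def)
  show ?case
  proof (cases "u = v")
    case True
    then show ?thesis using v eq by simp
  next
    case False
    then have "u \<in> pverts (tree_of (hd (anc w)))"
        "u \<rightarrow>\<^sup>*\<^bsub>with_proj (tree_of (hd (anc w)))\<^esub> w"
      using child by auto
    moreover have "w \<rightarrow>\<^bsub>with_proj (tree_of (hd (anc w)))\<^esub> v"
      using tree_arc[OF child(1-3)] by simp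
    ultimately show ?thesis using T.reachable_adj_trans eq by auto
  qed
qed

definition forest_of :: "('a pair_pre_digraph \<times> 'a) set" where
  "forest_of = (\<lambda>r. (tree_of r, r)) ` roots"

lemma elimination_forest_forest_of:
  assumes "finite X" "verts G = X"
    and adj: "\<And>x y. (x, y) \<in> arcs_ends G \<Longrightarrow> x \<in> X \<and> y \<in> X \<and> (x \<in> set (anc y) \<or> y \<in> set (anc x))"
  shows "elimination_forest G forest_of"
  unfolding elimination_forest_def
proof (intro conjI)
  show "rooted_forest forest_of"
    unfolding rooted_forest_def forest_of_def
    using assms(1) rooted_tree_tree_of
    by (auto simp: roots_def disjoint_family_on_def tree_of_def)
  show "(\<Union>(T, r)\<in>forest_of. pverts T) = verts G"
    using hd_anc_root assms(2) by (auto simp: forest_of_def tree_of_def)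
  show "\<forall>(x, y)\<in>arcs_ends G. \<exists>(T, r)\<in>forest_of.
      x \<in> pverts T \<and> y \<in> pverts T \<and> (x \<rightarrow>\<^sup>*\<^bsub>with_proj T\<^esub> y \<or> y \<rightarrow>\<^sup>*\<^bsub>with_proj T\<^esub> x)"
  proof (clarify)
    fix x y assume "(x, y) \<in> arcs_ends G"
    then have xy: "x \<in> X" "y \<in> X" "x \<in> set (anc y) \<or> y \<in> set (anc x)" using adj by auto
    have tree: "\<exists>(T, r)\<in>forest_of. u \<in> pverts T \<and> v \<in> pverts T \<and> u \<rightarrow>\<^sup>*\<^bsub>with_proj T\<^esub> v"
      if "u \<in> X" "v \<in> X" "u \<in> set (anc v)" for u v
    proof -
      have "(tree_of (hd (anc v)), hd (anc v)) \<in> forest_of"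
        using hd_anc_root that by (auto simp: forest_of_def)
      moreover have "v \<in> pverts (tree_of (hd (anc v)))" using that by (simp add: tree_of_def)
      ultimately show ?thesis using reachable_anc that by blast
    qed
    show "\<exists>(T, r)\<in>forest_of.
      x \<in> pverts T \<and> y \<in> pverts T \<and> (x \<rightarrow>\<^sup>*\<^bsub>with_proj T\<^esub> y \<or> y \<rightarrow>\<^sup>*\<^bsub>with_proj T\<^esub> x)"
      using xy tree[of x y] tree[of y x] by blast
  qed
qed

lemma vertex_height_forest_of:
  assumes "\<And>v. v \<in> X \<Longrightarrow> length (anc v) \<le> n"
  shows "vertex_height forest_of \<le> n"
proof -
  let ?H = "{length (pre_digraph.awalk_verts (with_proj T) r p) | T r p l.
      (T, r) \<in> forest_of \<and> pre_digraph.apath (with_proj T) r p l \<and> out_arcs (with_proj T) l = {}}"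
  have "h \<le> n" if "h \<in> ?H" for h
  proof -
    from that obtain r p l where r: "r \<in> roots"
      and p: "pre_digraph.apath (with_proj (tree_of r)) r p l"
      and h: "h = length (pre_digraph.awalk_verts (with_proj (tree_of r)) r p)"
      by (auto simp: forest_of_def)
    interpret T: pair_wf_digraph "tree_of r" by (rule wf_tree_of)
    have "T.awalk r p l" using p by (simp add: T.apath_def)
    \<comment> \<open>A root has a one-entry list, so \<open>length (anc l)\<close> equals the
      number of vertices of the walk.\<close>
    then have "l \<in> X" "length (anc l) = Suc (length p)"
      using T.awalk_last_in_verts[of r p l] awalk_anc[of r p l] r
      by (simp_all add: tree_of_def roots_def)
    moreover have "h = Suc (length p)" using h T.length_awalk_verts by simp
    ultimately show ?thesis using assms by metis
  qed
  \<comment> \<open>\<open>cSup_least\<close> needs a nonempty set; the empty supremum of naturals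
    is 0.\<close>
  moreover have "Sup H \<le> n" if "\<And>h. h \<in> H \<Longrightarrow> h \<le> n" for H :: "nat set"
    using that by (cases "H = {}") (simp_all add: cSup_least)
  ultimately show ?thesis unfolding vertex_height_def by blast
qed

end

context adjacency
begin

text \<open>A removed vertex becomes the root above all others, lengthening every list by one; a
  disjoint union puts two forests side by side.\<close>

lemma td_le_ancestor_lists:
  assumes "td_le X n"
  obtains anc where "ancestor_lists X anc" "\<forall>v\<in>X. length (anc v) \<le> n"
    "\<forall>x\<in>X. \<forall>y\<in>X. adj x y \<longrightarrow> x \<in> set (anc y) \<or> y \<in> set (anc x)"
proof -
  have "\<exists>anc. ancestor_lists X anc \<and> (\<forall>v\<in>X. length (anc v) \<le> n) \<and>
      (\<forall>x\<in>X. \<forall>y\<in>X. adj x y \<longrightarrow> x \<in> set (anc y) \<or> y \<in> set (anc x))"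
    using assms
  proof (induction rule: td_le.induct)
    case (empty n)
    then show ?case by (simp add: ancestor_lists_def)
  next
    case (remove x X n)
    then obtain anc where anc: "ancestor_lists (X - {x}) anc" "\<forall>v\<in>X - {x}. length (anc v) \<le> n"
      "\<forall>u\<in>X - {x}. \<forall>v\<in>X - {x}. adj u v \<longrightarrow> u \<in> set (anc v) \<or> v \<in> set (anc u)"
      by blast
    let ?anc = "\<lambda>v. if v = x then [x] else x # anc v"
    have "ancestor_lists X ?anc"
    proof
      fix v assume v: "v \<in> X"
      show "?anc v = [v] \<or> (\<exists>u\<in>X. ?anc v = ?anc u @ [v])"
      proof (cases "v = x")
        case False
        then consider "anc v = [v]" | u where "u \<in> X - {x}" "anc v = anc u @ [v]"
          using ancestor_lists.anc_cases[OF anc(1), of v] v by blast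
        then show ?thesis
        proof cases
          case 1
          then show ?thesis using False remove.hyps(1) by (intro disjI2 bexI[of _ x]) auto
        next
          case 2
          then show ?thesis using False by (intro disjI2 bexI[of _ u]) auto
        qed
      qed simp
    qed
    moreover have "anc v \<noteq> []" if "v \<in> X - {x}" for v
      using ancestor_lists.anc_nonempty[OF anc(1) that] .
    then have "v \<in> set (anc v)" if "v \<in> X - {x}" for v
      using ancestor_lists.last_anc[OF anc(1) that] last_in_set that by metis
    ultimately show ?case using anc(2,3) by (intro exI[of _ ?anc]) auto
  next
    case (disjoint_union X n Y)
    then obtain f g where f: "ancestor_lists X f" "\<forall>v\<in>X. length (f v) \<le> n"
      "\<forall>u\<in>X. \<forall>v\<in>X. adj u v \<longrightarrow> u \<in> set (f v) \<or> v \<in> set (f u)"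
      and g: "ancestor_lists Y g" "\<forall>v\<in>Y. length (g v) \<le> n"
      "\<forall>u\<in>Y. \<forall>v\<in>Y. adj u v \<longrightarrow> u \<in> set (g v) \<or> v \<in> set (g u)"
      by blast
    let ?anc = "\<lambda>v. if v \<in> X then f v else g v"
    have notX: "v \<notin> X" if "v \<in> Y" for v using that disjoint_union.hyps by blast
    have "ancestor_lists (X \<union> Y) ?anc"
    proof
      fix v assume "v \<in> X \<union> Y"
      then consider "v \<in> X" | "v \<in> Y" "v \<notin> X" by blast
      then show "?anc v = [v] \<or> (\<exists>u\<in>X \<union> Y. ?anc v = ?anc u @ [v])"
      proof cases
        case 1
        then show ?thesis using ancestor_lists.anc_cases[OF f(1) 1] by auto
      next
        case 2
        then show ?thesis using ancestor_lists.anc_cases[OF g(1) 2(1)] notX by auto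
      qed
    qed
    moreover have "\<not> adj x y" "\<not> adj y x" if "x \<in> X" "y \<in> Y" for x y
      using disjoint_union.hyps(4)[OF that] adj_sym by blast+
    ultimately show ?case using f(2,3) g(2,3) notX by (intro exI[of _ ?anc]) auto
  qed
  then show thesis by (elim exE conjE) (rule that)
qed

end

lemma adjacency_arcs_ends: "graph G \<Longrightarrow> adjacency (\<lambda>x y. (x, y) \<in> arcs_ends G)"
  by unfold_locales (metis graph.axioms(2) pseudo_graph.axioms(2) sym_digraph.sym_arcs symD symmetric_def)

lemma treedepth_le:
  assumes "graph G" and td: "adjacency.td_le (\<lambda>x y. (x, y) \<in> arcs_ends G) (verts G) n"
  shows "treedepth G \<le> n"
proof -
  interpret graph G by fact
  interpret adjacency "\<lambda>x y. (x, y) \<in> arcs_ends G" using assms(1) by (rule adjacency_arcs_ends)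
  obtain anc where anc: "ancestor_lists (verts G) anc" "\<forall>v\<in>verts G. length (anc v) \<le> n"
    "\<forall>x\<in>verts G. \<forall>y\<in>verts G. (x, y) \<in> arcs_ends G \<longrightarrow> x \<in> set (anc y) \<or> y \<in> set (anc x)"
    using td by (rule td_le_ancestor_lists)
  interpret A: ancestor_lists "verts G" anc by fact
  have "elimination_forest G A.forest_of"
  proof (rule A.elimination_forest_forest_of)
    fix x y assume xy: "(x, y) \<in> arcs_ends G"
    then have "x \<in> verts G" "y \<in> verts G" by (auto dest: adj_in_verts)
    then show "x \<in> verts G \<and> y \<in> verts G \<and> (x \<in> set (anc y) \<or> y \<in> set (anc x))"
      using anc(3) xy by blast
  qed simp_all
  then have "treedepth G \<le> vertex_height A.forest_of"
    unfolding treedepth_def by (intro Least_le) blast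
  also have "\<dots> \<le> n" using anc(2) by (intro A.vertex_height_forest_of) blast
  finally show ?thesis .
qed

section \<open>From vertex sets to graphs\<close>

text \<open>\<open>H\<close> will be \<open>G\<close> or \<open>G\<close> minus a vertex, while the
  adjacency stays that of \<open>G\<close>, so deleting a vertex only shrinks the vertex set.
  Connectedness is strong connectedness of the symmetric closure, hence the premise on
  \<open>mk_symmetric H\<close>.\<close>

lemma connected_imp_conn:
  assumes "graph G" "Digraph_Component.connected H"
    and "\<And>x y. (x, y) \<in> parcs (mk_symmetric H) \<Longrightarrow>
      x \<in> verts H \<and> y \<in> verts H \<and> (x, y) \<in> arcs_ends G"
  shows "adjacency.conn (\<lambda>x y. (x, y) \<in> arcs_ends G) (verts H)"
proof -
  interpret adjacency "\<lambda>x y. (x, y) \<in> arcs_ends G" using assms(1) by (rule adjacency_arcs_ends)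
  have "reach (verts H) u v" if "u \<rightarrow>\<^sup>*\<^bsub>with_proj (mk_symmetric H)\<^esub> v" for u v
  proof -
    have "(u, v) \<in> rtrancl_on (verts H) (parcs (mk_symmetric H))"
      using that by (simp add: reachable_def)
    then show ?thesis
      by (induction rule: rtrancl_on_induct) (use assms(3) in \<open>auto intro: reach_step\<close>)
  qed
  then show ?thesis
    using assms(2) by (auto simp: connected_def strongly_connected_def conn_def)
qed

lemma vpath_imp_awalk:
  assumes "graph G" "adjacency.vpath (\<lambda>x y. (x, y) \<in> arcs_ends G) (verts G) p"
  shows "\<exists>es. pre_digraph.awalk G (hd p) es (last p) \<and> pre_digraph.awalk_verts G (hd p) es = p"
proof -
  interpret graph G by fact
  interpret adjacency "\<lambda>x y. (x, y) \<in> arcs_ends G" using assms(1) by (rule adjacency_arcs_ends)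
  from assms(2) show ?thesis
  proof (induction p)
    case Nil
    then show ?case by (simp add: vpath_def)
  next
    case (Cons x p)
    show ?case
    proof (cases "p = []")
      case True
      then show ?thesis using Cons.prems
        by (intro exI[of _ "[]"]) (auto simp: vpath_def awalk_Nil_iff)
    next
      case False
      then have "vpath (verts G) p" "(x, hd p) \<in> arcs_ends G"
        using Cons.prems by (auto simp: vpath_def successively_Cons)
      then obtain es e where "awalk (hd p) es (last p)" "awalk_verts (hd p) es = p"
        and "e \<in> arcs G" "tail G e = x" "head G e = hd p"
        using Cons.IH by (auto simp: arcs_ends_conv)
      then show ?thesis using False by (intro exI[of _ "e # es"]) (auto simp: awalk_Cons_iff)
    qed
  qed
qed

text \<open>Makes the \<open>Max\<close> in \<open>circumference\<close> meaningful. The vertices of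
  a cycle after the first entry are distinct.\<close>

lemma finite_graph_cycle_lengths:
  assumes "graph G"
  shows "finite {length C | C. graph_cycle G C}"
proof -
  interpret graph G by fact
  have "length C \<le> card (verts G)" if "graph_cycle G C" for C
  proof -
    from that obtain u where u: "awalk u C u" "distinct (tl (awalk_verts u C))"
      by (auto simp: graph_cycle_def cycle_def)
    have "set (tl (awalk_verts u C)) \<subseteq> verts G"
      using u(1) awalk_verts_in_verts[of u C] list.set_sel(2)[of "awalk_verts u C"]
      by (auto simp: awalk_def)
    then have "length (tl (awalk_verts u C)) \<le> card (verts G)"
      using u(2) by (metis card_mono distinct_card finite_verts)
    then show ?thesis by (simp add: length_awalk_verts)
  qed
  then have "{length C | C. graph_cycle G C} \<subseteq> {..card (verts G)}" by auto
  then show ?thesis by (rule finite_subset) simp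
qed

theorem theorem2:
  fixes G :: "('a, 'b) pre_digraph"
  assumes "graph G" and "two_connected G"
  shows "(\<forall>e \<in> arcs G. \<exists>C. graph_cycle G C \<and> e \<in> set C \<and> treedepth G \<le> length C)
    \<and> enat (treedepth G) \<le> circumference G"
proof -
  interpret graph G by fact
  interpret adjacency "\<lambda>x y. (x, y) \<in> arcs_ends G" using assms(1) by (rule adjacency_arcs_ends)
  have sym: "parcs (mk_symmetric G) = arcs_ends G" by (rule adj_mk_symmetric_eq[OF sym_arcs])
  have conn: "conn (verts G)"
    using assms(2) sym by (intro connected_imp_conn[OF assms(1)]) (auto simp: two_connected_def)
  have conn': "\<forall>d\<in>verts G. conn (verts G - {d})"
  proof
    fix d assume "d \<in> verts G"
    then have "Digraph_Component.connected (del_vert d)"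
      using assms(2) by (simp add: two_connected_def cutvertex_def)
    moreover have "x \<in> verts (del_vert d) \<and> y \<in> verts (del_vert d) \<and> (x, y) \<in> arcs_ends G"
      if "(x, y) \<in> parcs (mk_symmetric (del_vert d))" for x y
    proof -
      from that obtain e where "e \<in> arcs G" "tail G e \<noteq> d" "head G e \<noteq> d"
        "(x, y) = (tail G e, head G e) \<or> (x, y) = (head G e, tail G e)"
        by (auto simp: parcs_mk_symmetric del_vert_simps)
      moreover from this have "(x, y) \<in> parcs (mk_symmetric G)"
        by (auto simp: parcs_mk_symmetric)
      ultimately show ?thesis using sym by (auto simp: del_vert_simps)
    qed
    ultimately have "conn (verts (del_vert d))" by (rule connected_imp_conn[OF assms(1)])
    then show "conn (verts G - {d})" by (simp add: del_vert_simps)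
  qed
  have card: "3 \<le> card (verts G)" using assms(2) by (simp add: two_connected_def)
  have cycle: "\<exists>C. graph_cycle G C \<and> e \<in> set C \<and> treedepth G \<le> length C" if e: "e \<in> arcs G" for e
  proof -
    have neq: "head G e \<noteq> tail G e" using no_loops[OF e] by simp
    then have ne: "verts G \<noteq> {head G e, tail G e}" using card by auto
    have IH: "\<forall>L. L \<subset> verts G \<longrightarrow> linking L"
      using linking_finite finite_subset[OF _ finite_verts] by blast
    \<comment> \<open>The path runs from the head of \<open>e\<close> back to its tail, so that
      prepending \<open>e\<close> closes it; \<open>ne\<close> yields the three vertices that a
      genuine cycle requires.\<close>
    obtain p where p: "vpath (verts G) p" "hd p = head G e" "last p = tail G e"
        "td_le (verts G) (length p)" "3 \<le> length p"
      by (rule long_path_of_two_connected[OF finite_verts conn conn' _ _ neq IH]) (use e ne in auto)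
    then obtain es where es: "awalk (head G e) es (tail G e)" "awalk_verts (head G e) es = p"
      using vpath_imp_awalk[OF assms(1) p(1)] by auto
    \<comment> \<open>\<open>es\<close> has one arc fewer than \<open>p\<close> has vertices, and
      \<open>e\<close> makes up for it.\<close>
    have len: "length (e # es) = length p" using es(2) length_awalk_verts by (metis length_Cons)
    have "awalk (tail G e) (e # es) (tail G e)" using es e by (simp add: awalk_Cons_iff)
    moreover have "distinct (tl (awalk_verts (tail G e) (e # es)))"
      using p(1) es by (simp add: vpath_def)
    ultimately have "graph_cycle G (e # es)"
      using p(5) len by (auto simp: graph_cycle_def cycle_def)
    moreover have "treedepth G \<le> length (e # es)"
      using treedepth_le[OF assms(1) p(4)] len by simp
    ultimately show ?thesis by (intro exI[of _ "e # es"]) simp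
  qed
  \<comment> \<open>Without an edge, \<open>cycle\<close> would provide no cycle to compare with the
    circumference.\<close>
  have "\<exists>e. e \<in> arcs G"
  proof (rule ccontr)
    assume "\<not> ?thesis"
    then have no_arcs: "arcs_ends G = {}" by (auto simp: arcs_ends_conv)
    have "x = y" if "x \<in> verts G" "y \<in> verts G" for x y
    proof (rule ccontr)
      assume "x \<noteq> y"
      moreover have "reach (verts G) x y" using conn that by (simp only: conn_def)
      ultimately obtain a b where "(a, b) \<in> arcs_ends G" by (blast elim: reach_exit[of _ x y "{x}"])
      then show False using no_arcs by blast
    qed
    then have "card (verts G) \<le> Suc 0" using card_le_Suc0_iff_eq[OF finite_verts] by blast
    then show False using card by simp
  qed
  then obtain C where C: "graph_cycle G C" "treedepth G \<le> length C" using cycle by blast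
  then have "length C \<le> Max {length C | C. graph_cycle G C}"
    by (intro Max_ge finite_graph_cycle_lengths[OF assms(1)]) blast
  then have "enat (treedepth G) \<le> circumference G"
    using C unfolding circumference_def by auto
  then show ?thesis using cycle by blast
qed

end
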